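(* Under the regularity and protocol assumptions stated in the context, fix an integer $E\ge 1$. Then: (1) For a learner $\theta$ and a frozen source $\phi$, as $\eta\to 0$, $$\mathcal{F}_\eta(\theta;\phi)-\mathcal{P}_\eta(\theta;\phi)=\binom{E}{2}\eta^2\sum_i w_i(H_i-H)(g_i-g)+O(\eta^3),$$ where $g_i$ and $H_i=\partial_\theta g_i$ are evaluated at $(\theta;\phi)$, $g=\sum_i w_ig_i$ and $H=\sum_i w_iH_i$. (2) Consider the self-generated processes $\theta_{t+1}^F=\mathcal{F}_\eta(\theta_t^F;\theta_t^F)$ and $\theta_{t+1}^P=\mathcal{P}_\eta(\theta_t^P;\theta_t^P)$, and write $\delta_t=\theta_t^F-\theta_t^P$ and $e_t=\mathcal{F}_\eta(\theta_t^P;\theta_t^P)-\mathcal{P}_\eta(\theta_t^P;\theta_t^P)$. Then locally (for sufficiently small $\eta$, and with all points involved and the segments joining them in the neighborhood of the assumptions) $$\delta_{t+1}=\big[I-\eta E(H_t+B_t)\big]\delta_t+e_t+O\!\left(\eta^2\lVert\delta_t\rVert+\lVert\delta_t\rVert^2\right),$$ where $H_t=\sum_i w_i\,\partial_\theta g_i(\theta;\phi)\big|_{\theta=\phi=\theta_t^P}$ and $B_t=\sum_i w_i\,\partial_\phi g_i(\theta;\phi)\big|_{\theta=\phi=\theta_t^P}$. The constants in the $O(\cdot)$ terms are uniform over the neighborhood and over the sufficiently small step sizes considered, for fixed $E$.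
   Context: There are finitely many clients $i=1,\dots,K$ with fixed weights $w_i>0$, $\sum_i w_i=1$. For a learner parameter $\theta\in\mathbb{R}^d$ and a source (generator) parameter $\phi\in\mathbb{R}^d$, client $i$ has the fixed-source loss $L_i(\theta;\phi)=\mathbb{E}_{s\sim d_i^\phi}[\ell(\theta;s)]$, where $d_i^\phi$ is a probability distribution over states (prefixes) $s$ depending on $\phi$, and $\ell(\theta;s)$ is a loss depending on the learner. Its learner gradient is $g_i(\theta;\phi)=\nabla_\theta L_i(\theta;\phi)$. Write $\partial_\theta g_i$ and $\partial_\phi g_i$ for the Jacobians with respect to the first and second arguments. For step size $\eta>0$ the two round maps are: - $\mathcal{F}_\eta(\theta;\phi)=\sum_i w_i\theta_{i,E}$, where $\theta_{i,0}=\theta$ and $\theta_{i,e+1}=\theta_{i,e}-\eta g_i(\theta_{i,e};\phi)$ for $0\le e<E$ (local steps, then averaging); - $\mathcal{P}_\eta(\theta;\phi)=\theta_E$, where $\theta_0=\theta$ and $\theta_{e+1}=\theta_e-\eta\sum_i w_ig_i(\theta_e;\phi)$ for $0\le e<E$ (synchronous pooled steps). Assumptions: all clients participate in each round from a common starting learner, with exact gradient steps and the source frozen within a round. There is a compact parameter neighborhood containing all points used in the local expansions and the line segments between them. On it the functions $g_i(\theta;\phi)$ have bounded continuous derivatives through order two (jointly in $(\theta,\phi)$), with locally Lipschitz second derivatives. The state distributions have common support, and a dominating integrable function justifies differentiating the expectations with respect to learner and source. These bounds hold uniformly for the sufficiently small step sizes under consideration and for fixed $E$. *)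

theory Defs
  imports "HOL-Probability.Probability" "HOL-Library.Landau_Symbols"
begin

definition grad :: "('a::real_inner \<Rightarrow> real) \<Rightarrow> 'a \<Rightarrow> 'a" where
  "grad f x = (THE v. GDERIV f x :> v)"

definition client_loss ::
    "(nat \<Rightarrow> 'p \<Rightarrow> 's measure) \<Rightarrow> ('p \<Rightarrow> 's \<Rightarrow> real) \<Rightarrow> nat \<Rightarrow> 'p \<Rightarrow> 'p \<Rightarrow> real" where
  "client_loss d l i \<theta> \<phi> = (\<integral>s. l \<theta> s \<partial>(d i \<phi>))"

definition client_grad ::
    "(nat \<Rightarrow> 'p \<Rightarrow> 's measure) \<Rightarrow> ('p \<Rightarrow> 's \<Rightarrow> real) \<Rightarrow> nat \<Rightarrow> 'p \<Rightarrow> 'p \<Rightarrow> 'p::real_inner" where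
  "client_grad d l i \<theta> \<phi> = grad (\<lambda>x. client_loss d l i x \<phi>) \<theta>"

definition wmean :: "nat \<Rightarrow> (nat \<Rightarrow> real) \<Rightarrow> (nat \<Rightarrow> 'v) \<Rightarrow> 'v::real_vector" where
  "wmean K w x = (\<Sum>i=1..K. w i *\<^sub>R x i)"

primrec gd :: "real \<Rightarrow> ('v \<Rightarrow> 'v) \<Rightarrow> 'v \<Rightarrow> nat \<Rightarrow> 'v::real_vector" where
  "gd \<eta> G \<theta> 0 = \<theta>"
| "gd \<eta> G \<theta> (Suc e) = gd \<eta> G \<theta> e - \<eta> *\<^sub>R G (gd \<eta> G \<theta> e)"

definition fed_round ::
    "nat \<Rightarrow> (nat \<Rightarrow> real) \<Rightarrow> nat \<Rightarrow> (nat \<Rightarrow> 'v \<Rightarrow> 'v \<Rightarrow> 'v) \<Rightarrow> real \<Rightarrow> 'v \<Rightarrow> 'v \<Rightarrow> 'v::real_vector" where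
  "fed_round K w E g \<eta> \<theta> \<phi> = wmean K w (\<lambda>i. gd \<eta> (\<lambda>x. g i x \<phi>) \<theta> E)"

definition pooled_round ::
    "nat \<Rightarrow> (nat \<Rightarrow> real) \<Rightarrow> nat \<Rightarrow> (nat \<Rightarrow> 'v \<Rightarrow> 'v \<Rightarrow> 'v) \<Rightarrow> real \<Rightarrow> 'v \<Rightarrow> 'v \<Rightarrow> 'v::real_vector" where
  "pooled_round K w E g \<eta> \<theta> \<phi> = gd \<eta> (\<lambda>x. wmean K w (\<lambda>i. g i x \<phi>)) \<theta> E"

definition learner_jac ::
    "(real^'n \<Rightarrow> real^'n \<Rightarrow> real^'n) \<Rightarrow> real^'n \<Rightarrow> real^'n \<Rightarrow> real^'n^'n" where
  "learner_jac h \<theta> \<phi> = jacobian (\<lambda>x. h x \<phi>) (at \<theta>)"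

definition source_jac ::
    "(real^'n \<Rightarrow> real^'n \<Rightarrow> real^'n) \<Rightarrow> real^'n \<Rightarrow> real^'n \<Rightarrow> real^'n^'n" where
  "source_jac h \<theta> \<phi> = jacobian (\<lambda>y. h \<theta> y) (at \<phi>)"

definition client_drift ::
    "nat \<Rightarrow> (nat \<Rightarrow> real) \<Rightarrow> (nat \<Rightarrow> real^'n \<Rightarrow> real^'n \<Rightarrow> real^'n) \<Rightarrow> real^'n \<Rightarrow> real^'n \<Rightarrow> real^'n" where
  "client_drift K w g \<theta> \<phi> =
    wmean K w (\<lambda>i.
      (learner_jac (g i) \<theta> \<phi> - wmean K w (\<lambda>j. learner_jac (g j) \<theta> \<phi>))
        *v (g i \<theta> \<phi> - wmean K w (\<lambda>j. g j \<theta> \<phi>)))"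

text \<open>The (learner, source) pairs at which gradients are evaluated during one round; the
  output of the last step is not among them.\<close>

definition fed_points ::
    "nat \<Rightarrow> nat \<Rightarrow> (nat \<Rightarrow> 'v \<Rightarrow> 'v \<Rightarrow> 'v) \<Rightarrow> real \<Rightarrow> 'v \<Rightarrow> 'v \<Rightarrow> ('v::real_vector \<times> 'v) set" where
  "fed_points K E g \<eta> \<theta> \<phi> = {(gd \<eta> (\<lambda>x. g i x \<phi>) \<theta> e, \<phi>) | i e. i \<in> {1..K} \<and> e < E}"

definition pooled_points ::
    "nat \<Rightarrow> (nat \<Rightarrow> real) \<Rightarrow> nat \<Rightarrow> (nat \<Rightarrow> 'v \<Rightarrow> 'v \<Rightarrow> 'v) \<Rightarrow> real \<Rightarrow> 'v \<Rightarrow> 'v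
      \<Rightarrow> ('v::real_vector \<times> 'v) set" where
  "pooled_points K w E g \<eta> \<theta> \<phi> = {(gd \<eta> (\<lambda>x. wmean K w (\<lambda>i. g i x \<phi>)) \<theta> e, \<phi>) | e. e < E}"

text \<open>Taking \<open>x = y\<close> shows that the points themselves lie in \<open>N\<close>.\<close>

definition segments_in :: "'v::real_vector set \<Rightarrow> 'v set \<Rightarrow> bool" where
  "segments_in N A \<longleftrightarrow> (\<forall>x\<in>A. \<forall>y\<in>A. closed_segment x y \<subseteq> N)"

text \<open>Smoothness on a compact set \<open>N\<close> is understood as smoothness on an open set \<open>U\<close>
  containing it, so that derivatives at boundary points of \<open>N\<close> are the ordinary two-sided ones.\<close>

definition C2_regular ::
    "'a::real_normed_vector set \<Rightarrow> 'a set \<Rightarrow> ('a \<Rightarrow> 'b::real_normed_vector) \<Rightarrow> bool" where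
  "C2_regular U N f \<longleftrightarrow>
    (\<exists>(f' :: 'a \<Rightarrow> 'a \<Rightarrow>\<^sub>L 'b) (f'' :: 'a \<Rightarrow> 'a \<Rightarrow>\<^sub>L 'a \<Rightarrow>\<^sub>L 'b).
       (\<forall>x\<in>U. (f has_derivative blinfun_apply (f' x)) (at x)) \<and>
       (\<forall>x\<in>U. (f' has_derivative blinfun_apply (f'' x)) (at x)) \<and>
       continuous_on U f'' \<and>
       bounded (f ` N) \<and> bounded (f' ` N) \<and> bounded (f'' ` N) \<and>
       (\<forall>x\<in>U. \<exists>r>0. \<exists>L. L-lipschitz_on (ball x r \<inter> U) f''))"

text \<open>The hypotheses for differentiating \<open>\<lambda>x. \<integral>s. f x s \<partial>M\<close> under the integral sign on \<open>U\<close>.\<close>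

definition dominated_diff ::
    "'s measure \<Rightarrow> 'a::real_normed_vector set
      \<Rightarrow> ('a \<Rightarrow> 's \<Rightarrow> 'b::{banach, second_countable_topology}) \<Rightarrow> bool" where
  "dominated_diff M U f \<longleftrightarrow>
    (\<forall>x\<in>U. integrable M (f x)) \<and>
    (AE s in M. \<forall>x\<in>U. (\<lambda>x. f x s) differentiable (at x)) \<and>
    (\<exists>G :: 's \<Rightarrow> real. integrable M G \<and>
       (AE s in M. \<forall>x\<in>U. onorm (frechet_derivative (\<lambda>x. f x s) (at x)) \<le> G s))"

end

theory Submission
  imports Defs
begin

text \<open>
  With \<open>G\<close> the gradient field at a frozen source, two Taylor expansions along the local steps give
  \<open>\<theta>\<^sub>E = \<theta> - \<eta>E G(\<theta>) + \<eta>\<^sup>2 (E choose 2) DG(\<theta>) G(\<theta>) + O(\<eta>\<^sup>3)\<close>. For the clients and for the pooled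
  gradient the first two terms have the same mean, and the third terms differ by
  \<open>\<Sum>w\<^sub>i H\<^sub>i g\<^sub>i - H g\<close>, which is the covariance \<open>\<Sum>w\<^sub>i (H\<^sub>i - H) (g\<^sub>i - g)\<close>.

  For the self-generated processes, \<open>\<delta>\<^sub>t\<^sub>+\<^sub>1 - e\<^sub>t\<close> compares two rounds of the same map started from
  the pairs \<open>(\<theta>, \<theta>)\<close> of the two processes. The distance of the two local paths stays \<open>O(|\<delta>\<^sub>t|)\<close> and
  each path moves by \<open>O(\<eta>)\<close>, so each step changes the difference by
  \<open>-\<eta> Dg\<^sub>i (\<delta>\<^sub>t, \<delta>\<^sub>t) + O(\<eta>\<^sup>2 |\<delta>\<^sub>t| + \<eta> |\<delta>\<^sub>t|\<^sup>2)\<close>.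
\<close>

section \<open>Segments in the neighborhood and weighted means\<close>

lemma segments_inD:
  "segments_in N A \<Longrightarrow> x \<in> A \<Longrightarrow> y \<in> A \<Longrightarrow> closed_segment x y \<subseteq> N"
  by (auto simp: segments_in_def)

lemma segments_in_point: "segments_in N A \<Longrightarrow> x \<in> A \<Longrightarrow> x \<in> N"
  using segments_inD[of N A x x] by auto

lemma segments_in_mono: "segments_in N A \<Longrightarrow> B \<subseteq> A \<Longrightarrow> segments_in N B"
  by (auto simp: segments_in_def)

lemma segments_in_convex: "convex C \<Longrightarrow> A \<subseteq> C \<Longrightarrow> C \<subseteq> N \<Longrightarrow> segments_in N A"
  unfolding segments_in_def by (meson closed_segment_subset subsetD subset_trans)

lemma wmean_diff: "wmean K w (\<lambda>i. x i - y i) = wmean K w x - wmean K w y"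
  by (simp add: wmean_def scaleR_diff_right sum_subtractf)

lemma wmean_add: "wmean K w (\<lambda>i. x i + y i) = wmean K w x + wmean K w y"
  by (simp add: wmean_def scaleR_add_right sum.distrib)

lemma wmean_const: "(\<Sum>i=1..K. w i) = 1 \<Longrightarrow> wmean K w (\<lambda>i. c) = c"
  by (simp add: wmean_def flip: scaleR_left.sum)

lemma wmean_linear: "linear h \<Longrightarrow> wmean K w (\<lambda>i. h (x i)) = h (wmean K w x)"
  by (simp add: wmean_def linear_sum linear_scale)

lemma wmean_scaleR: "wmean K w (\<lambda>i. c *\<^sub>R x i) = c *\<^sub>R wmean K w x"
  by (rule wmean_linear) (rule linear_scaleR)

lemma norm_wmean_le:
  fixes x :: "nat \<Rightarrow> 'v::real_normed_vector"
  assumes "\<And>i. i \<in> {1..K} \<Longrightarrow> w i \<ge> 0" "(\<Sum>i=1..K. w i) = 1"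
    and "\<And>i. i \<in> {1..K} \<Longrightarrow> norm (x i) \<le> b"
  shows "norm (wmean K w x) \<le> b"
proof -
  have "norm (wmean K w x) \<le> (\<Sum>i=1..K. norm (w i *\<^sub>R x i))"
    unfolding wmean_def by (rule norm_sum)
  also have "\<dots> \<le> (\<Sum>i=1..K. w i * b)"
    using assms by (intro sum_mono) (auto intro!: mult_mono)
  also have "\<dots> = b"
    using assms(2) by (simp flip: sum_distrib_right)
  finally show ?thesis .
qed

text \<open>The covariance identity for a matrix-vector product. After expansion, three of the four
  terms equal \<open>wmean K w A *v wmean K w x\<close> up to sign: two by linearity of the mean,
  one because the weights sum to 1. The signs leave a single negative copy.\<close>

lemma wmean_centered_product:
  fixes A :: "nat \<Rightarrow> real^'n^'m" and x :: "nat \<Rightarrow> real^'n"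
  assumes "(\<Sum>i=1..K. w i) = 1"
  shows "wmean K w (\<lambda>i. (A i - wmean K w A) *v (x i - wmean K w x))
    = wmean K w (\<lambda>i. A i *v x i) - wmean K w A *v wmean K w x"
proof -
  have lin: "linear (\<lambda>B :: real^'n^'m. B *v v)" for v
    by (intro linearI) (auto simp: matrix_vector_mult_add_rdistrib scaleR_matrix_vector_assoc)
  have "wmean K w (\<lambda>i. (A i - wmean K w A) *v (x i - wmean K w x))
      = wmean K w (\<lambda>i. A i *v x i) - wmean K w (\<lambda>i. wmean K w A *v x i)
        - (wmean K w (\<lambda>i. A i *v wmean K w x) - wmean K w (\<lambda>i. wmean K w A *v wmean K w x))"
    by (simp only: wmean_diff matrix_vector_mult_diff_distrib matrix_vector_mult_diff_rdistrib)
  then show ?thesis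
    using assms by (simp add: wmean_const wmean_linear[OF lin]
        wmean_linear[OF matrix_vector_mul_linear[of "wmean K w A"]])
qed

section \<open>Quantitative bounds for twice differentiable fields\<close>

text \<open>The second derivative enters the proof only through the last clause, which, unlike
  \<^const>\<open>C2_regular\<close>, is inherited by convex combinations with the same constant.\<close>

definition C2_bound ::
    "'a::real_normed_vector set \<Rightarrow> real \<Rightarrow> ('a \<Rightarrow> 'b::real_normed_vector)
      \<Rightarrow> ('a \<Rightarrow> 'a \<Rightarrow>\<^sub>L 'b) \<Rightarrow> bool" where
  "C2_bound N M f f' \<longleftrightarrow> 0 \<le> M \<and>
    (\<forall>x\<in>N. (f has_derivative blinfun_apply (f' x)) (at x)) \<and>
    (\<forall>x\<in>N. norm (f x) \<le> M \<and> norm (f' x) \<le> M) \<and>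
    (\<forall>x y. closed_segment x y \<subseteq> N \<longrightarrow> norm (f' y - f' x) \<le> M * norm (y - x))"

lemma C2_bound_nonneg: "C2_bound N M f f' \<Longrightarrow> 0 \<le> M"
  and C2_bound_deriv:
    "C2_bound N M f f' \<Longrightarrow> x \<in> N \<Longrightarrow> (f has_derivative blinfun_apply (f' x)) (at x)"
  and C2_bound_norm: "C2_bound N M f f' \<Longrightarrow> x \<in> N \<Longrightarrow> norm (f x) \<le> M"
  and C2_bound_norm_deriv: "C2_bound N M f f' \<Longrightarrow> x \<in> N \<Longrightarrow> norm (f' x) \<le> M"
  and C2_bound_deriv_lipschitz:
    "C2_bound N M f f' \<Longrightarrow> closed_segment x y \<subseteq> N \<Longrightarrow> norm (f' y - f' x) \<le> M * norm (y - x)"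
  by (auto simp: C2_bound_def)

lemma C2_bound_apply:
  assumes "C2_bound N M f f'" "x \<in> N"
  shows "norm (f' x v) \<le> M * norm v"
  using norm_blinfun[of "f' x" v] mult_right_mono[OF C2_bound_norm_deriv[OF assms], of "norm v"]
  by simp

lemma C2_bound_mono:
  assumes "C2_bound N M f f'" "M \<le> M'"
  shows "C2_bound N M' f f'"
proof -
  have "M * norm v \<le> M' * norm v" for v :: 'a
    using assms(2) by (rule mult_right_mono) simp
  with assms show ?thesis unfolding C2_bound_def by (meson order_trans)
qed

text \<open>The mean value inequality along one segment; \<open>N\<close> itself need not be convex.
  It serves both for a field with derivative \<open>f'\<close> and, one level higher, for
  \<open>f'\<close> with derivative \<open>f''\<close>.\<close>

lemma segment_bound:
  fixes f :: "'a::real_normed_vector \<Rightarrow> 'b::real_normed_vector"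
  assumes seg: "closed_segment x y \<subseteq> N"
    and f: "\<And>z. z \<in> N \<Longrightarrow> (f has_derivative blinfun_apply (f' z)) (at z)"
    and M: "\<And>z. z \<in> N \<Longrightarrow> norm (f' z) \<le> M"
  shows "norm (f y - f x) \<le> M * norm (y - x)"
proof (rule differentiable_bound[where S = "closed_segment x y"])
  fix z assume "z \<in> closed_segment x y"
  with seg have "z \<in> N" by auto
  then show "(f has_derivative blinfun_apply (f' z)) (at z within closed_segment x y)"
    "onorm (blinfun_apply (f' z)) \<le> M"
    using has_derivative_at_withinI[OF f] M by (auto simp: norm_blinfun.rep_eq)
qed auto

lemma C2_bound_lipschitz:
  assumes "C2_bound N M f f'" "closed_segment x y \<subseteq> N"
  shows "norm (f y - f x) \<le> M * norm (y - x)"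
  using segment_bound[OF assms(2)] C2_bound_deriv[OF assms(1)] C2_bound_norm_deriv[OF assms(1)]
  by blast

text \<open>On the segment the derivative differs from its value at \<open>x\<close> by at most
  \<open>M * norm (y - x)\<close>, so the mean value inequality for the linearization gives a
  quadratic remainder. The sharper factor 1/2 would only change the constants of the
  O-terms.\<close>

lemma C2_bound_taylor:
  fixes f :: "'a::real_normed_vector \<Rightarrow> 'b::real_normed_vector"
  assumes f: "C2_bound N M f f'" and seg: "closed_segment x y \<subseteq> N"
  shows "norm (f y - f x - f' x (y - x)) \<le> M * (norm (y - x))\<^sup>2"
proof -
  have "norm (f y - f x - blinfun_apply (f' x) (y - x)) \<le> norm (y - x) * (M * norm (y - x))"
  proof (rule differentiable_bound_linearization[where S = "closed_segment x y"])
    fix t :: real assume "t \<in> {0..1}"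
    then show "x + t *\<^sub>R (y - x) \<in> closed_segment x y"
      by (auto simp: in_segment algebra_simps intro!: exI[of _ t])
  next
    fix z assume z: "z \<in> closed_segment x y"
    with seg show "(f has_derivative blinfun_apply (f' z)) (at z within closed_segment x y)"
      using C2_bound_deriv[OF f] has_derivative_at_withinI by blast
    \<comment> \<open>The Lipschitz clause for \<open>f'\<close> asks for a whole segment inside
      \<open>N\<close>; the initial piece from \<open>x\<close> to \<open>z\<close> inherits this
      from the full segment.\<close>
    have "closed_segment x z \<subseteq> N"
      using z seg by (meson ends_in_segment(1) subset_closed_segment subset_trans)
    then have "norm (f' z - f' x) \<le> M * norm (z - x)"
      by (rule C2_bound_deriv_lipschitz[OF f])
    also have "\<dots> \<le> M * norm (y - x)"
      using segment_bound1[OF z] C2_bound_nonneg[OF f] by (intro mult_left_mono)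
    finally show "onorm (blinfun_apply (f' z) - blinfun_apply (f' x)) \<le> M * norm (y - x)"
      by (simp add: norm_blinfun.rep_eq minus_blinfun.rep_eq fun_diff_def)
  qed auto
  then show ?thesis by (simp add: power2_eq_square mult_ac)
qed

text \<open>The Lipschitz clause for \<open>f'\<close> comes from the bound on \<open>f''\<close>
  through \<open>segment_bound\<close>; the other clauses are read off the regularity
  assumption.\<close>

lemma C2_regular_imp_C2_bound:
  assumes f: "C2_regular U N f" and "N \<subseteq> U"
  obtains M f' where "C2_bound N M f f'"
proof -
  obtain f' f'' where
    d: "\<And>x. x \<in> U \<Longrightarrow> (f has_derivative blinfun_apply (f' x)) (at x)"
       "\<And>x. x \<in> U \<Longrightarrow> (f' has_derivative blinfun_apply (f'' x)) (at x)"
    and b: "bounded (f ` N)" "bounded (f' ` N)" "bounded (f'' ` N)"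
    using f unfolding C2_regular_def by blast
  obtain A where A: "\<And>x. x \<in> N \<Longrightarrow> norm (f x) \<le> A"
    using b(1) unfolding bounded_iff by blast
  obtain B where B: "\<And>x. x \<in> N \<Longrightarrow> norm (f' x) \<le> B"
    using b(2) unfolding bounded_iff by blast
  obtain C where C: "\<And>x. x \<in> N \<Longrightarrow> norm (f'' x) \<le> C"
    using b(3) unfolding bounded_iff by blast
  \<comment> \<open>The 0 secures \<open>0 \<le> M\<close> even for empty \<open>N\<close>, where
    \<open>A\<close>, \<open>B\<close> and \<open>C\<close> may be negative.\<close>
  define M where "M = max 0 (max A (max B C))"
  have ABC: "A \<le> M" "B \<le> M" "C \<le> M" by (auto simp: M_def)
  have M: "0 \<le> M" "\<And>x. x \<in> N \<Longrightarrow> norm (f x) \<le> M" "\<And>x. x \<in> N \<Longrightarrow> norm (f' x) \<le> M"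
      "\<And>x. x \<in> N \<Longrightarrow> norm (f'' x) \<le> M"
    using order_trans[OF A ABC(1)] order_trans[OF B ABC(2)] order_trans[OF C ABC(3)]
    by (simp_all add: M_def)
  have "C2_bound N M f f'"
    unfolding C2_bound_def
  proof (intro conjI ballI allI impI)
    fix x y assume "closed_segment x y \<subseteq> N"
    then show "norm (f' y - f' x) \<le> M * norm (y - x)"
      by (rule segment_bound[where f' = f'']) (use d M \<open>N \<subseteq> U\<close> in auto)
  qed (use d M \<open>N \<subseteq> U\<close> in auto)
  then show thesis by (rule that)
qed

text \<open>There are finitely many clients, so the sum of the absolute values of their constants
  dominates each one. This single \<open>M\<close> makes all later constants uniform.\<close>

lemma C2_bound_common:
  fixes f :: "nat \<Rightarrow> 'a::real_normed_vector \<Rightarrow> 'b::real_normed_vector"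
  assumes "\<And>i. i \<in> {1..K} \<Longrightarrow> C2_regular U N (f i)" "N \<subseteq> U"
  obtains M f' where "0 \<le> M" "\<And>i. i \<in> {1..K} \<Longrightarrow> C2_bound N M (f i) (f' i)"
proof -
  have "\<exists>M f'. C2_bound N M (f i) f'" if "i \<in> {1..K}" for i
    using C2_regular_imp_C2_bound[OF assms(1)[OF that] assms(2)] by blast
  then obtain M f' where M: "\<And>i. i \<in> {1..K} \<Longrightarrow> C2_bound N (M i) (f i) (f' i)"
    by metis
  define M' where "M' = (\<Sum>i=1..K. \<bar>M i\<bar>)"
  have "C2_bound N M' (f i) (f' i)" if "i \<in> {1..K}" for i
  proof -
    have "\<bar>M i\<bar> \<le> M'" unfolding M'_def using that by (intro member_le_sum) auto
    then show ?thesis using C2_bound_mono[OF M[OF that]] by auto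
  qed
  moreover have "0 \<le> M'" by (simp add: M'_def sum_nonneg)
  ultimately show thesis using that by blast
qed

text \<open>Each clause passes through a convex combination: derivatives by linearity, bounds by the
  triangle inequality. The pooled gradient thus obeys the same \<open>M\<close> as the clients, and
  every estimate for a single descent path covers pooled steps as well.\<close>

lemma C2_bound_wmean:
  fixes f :: "nat \<Rightarrow> 'a::real_normed_vector \<Rightarrow> 'b::real_normed_vector"
  assumes w: "\<And>i. i \<in> {1..K} \<Longrightarrow> w i \<ge> 0" "(\<Sum>i=1..K. w i) = 1" and M: "0 \<le> M"
    and f: "\<And>i. i \<in> {1..K} \<Longrightarrow> C2_bound N M (f i) (f' i)"
  shows "C2_bound N M (\<lambda>x. wmean K w (\<lambda>i. f i x)) (\<lambda>x. wmean K w (\<lambda>i. f' i x))"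
  unfolding C2_bound_def
proof (intro conjI ballI allI impI)
  fix x assume x: "x \<in> N"
  show "((\<lambda>x. wmean K w (\<lambda>i. f i x)) has_derivative blinfun_apply (wmean K w (\<lambda>i. f' i x))) (at x)"
    unfolding wmean_def blinfun.sum_left blinfun.scaleR_left
    by (intro has_derivative_sum has_derivative_scaleR_right C2_bound_deriv[OF f x])
  show "norm (wmean K w (\<lambda>i. f i x)) \<le> M" "norm (wmean K w (\<lambda>i. f' i x)) \<le> M"
    using C2_bound_norm[OF f x] C2_bound_norm_deriv[OF f x] by (auto intro!: norm_wmean_le[OF w])
next
  fix x y assume "closed_segment x y \<subseteq> N"
  then show "norm (wmean K w (\<lambda>i. f' i y) - wmean K w (\<lambda>i. f' i x)) \<le> M * norm (y - x)"
    unfolding wmean_diff[symmetric] by (intro norm_wmean_le[OF w] C2_bound_deriv_lipschitz[OF f])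
qed (rule M)

section \<open>Jacobians as partial derivatives of the joint derivative\<close>

text \<open>The chain rule along \<open>\<lambda>x. (x, \<phi>)\<close> gives the partial
  derivative. It also supplies the differentiability under which \<open>jacobian\<close> represents
  the derivative, and uniqueness of derivatives identifies the two.\<close>

lemma C2_bound_learner_jac:
  fixes h :: "real^'n \<Rightarrow> real^'n \<Rightarrow> real^'n"
  assumes "C2_bound N M (\<lambda>(\<theta>, \<phi>). h \<theta> \<phi>) h'" "(\<theta>, \<phi>) \<in> N"
  shows "learner_jac h \<theta> \<phi> *v v = h' (\<theta>, \<phi>) (v, 0)"
proof -
  have "((\<lambda>x. (x, \<phi>)) has_derivative (\<lambda>v. (v, 0))) (at \<theta>)"
    by (auto intro!: derivative_eq_intros)
  from has_derivative_compose[OF this C2_bound_deriv[OF assms]]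
  have d: "((\<lambda>x. h x \<phi>) has_derivative (\<lambda>v. h' (\<theta>, \<phi>) (v, 0))) (at \<theta>)"
    by simp
  then have "(\<lambda>x. h x \<phi>) differentiable at \<theta>" by (auto simp: differentiable_def)
  then have "((\<lambda>x. h x \<phi>) has_derivative (\<lambda>v. learner_jac h \<theta> \<phi> *v v)) (at \<theta>)"
    by (simp add: learner_jac_def jacobian_works)
  from has_derivative_unique[OF this d] show ?thesis by metis
qed

lemma C2_bound_source_jac:
  fixes h :: "real^'n \<Rightarrow> real^'n \<Rightarrow> real^'n"
  assumes "C2_bound N M (\<lambda>(\<theta>, \<phi>). h \<theta> \<phi>) h'" "(\<theta>, \<phi>) \<in> N"
  shows "source_jac h \<theta> \<phi> *v v = h' (\<theta>, \<phi>) (0, v)"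
proof -
  have "((\<lambda>y. (\<theta>, y)) has_derivative (\<lambda>v. (0, v))) (at \<phi>)"
    by (auto intro!: derivative_eq_intros)
  from has_derivative_compose[OF this C2_bound_deriv[OF assms]]
  have d: "((\<lambda>y. h \<theta> y) has_derivative (\<lambda>v. h' (\<theta>, \<phi>) (0, v))) (at \<phi>)"
    by simp
  then have "(\<lambda>y. h \<theta> y) differentiable at \<phi>" by (auto simp: differentiable_def)
  then have "((\<lambda>y. h \<theta> y) has_derivative (\<lambda>v. source_jac h \<theta> \<phi> *v v)) (at \<phi>)"
    by (simp add: source_jac_def jacobian_works)
  from has_derivative_unique[OF this d] show ?thesis by metis
qed

section \<open>Expansion of a single descent path\<close>

lemma norm_step_le:
  fixes a b :: "'v::real_normed_vector"
  assumes "norm a \<le> \<alpha>" "norm b \<le> \<beta>" "0 \<le> \<eta>"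
  shows "norm (a - \<eta> *\<^sub>R b) \<le> \<alpha> + \<eta> * \<beta>"
proof -
  have "norm (a - \<eta> *\<^sub>R b) \<le> norm a + norm (\<eta> *\<^sub>R b)"
    by (rule norm_triangle_ineq4)
  also have "\<dots> \<le> \<alpha> + \<eta> * \<beta>"
    using assms by (intro add_mono) (auto intro: mult_left_mono)
  finally show ?thesis .
qed

text \<open>Each step moves by at most \<open>\<eta> * M\<close>. Only the points strictly before
  \<open>e\<close> must lie in \<open>N\<close>, since no gradient is evaluated at the output; the
  later path lemmas keep this convention with \<open>e \<le> E\<close> and points indexed below
  \<open>E\<close>.\<close>

lemma gd_displacement:
  fixes f :: "'v::real_normed_vector \<times> 'w::real_normed_vector \<Rightarrow> 'v"
  assumes f: "\<And>z. z \<in> N \<Longrightarrow> norm (f z) \<le> M" and \<eta>: "0 \<le> \<eta>"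
    and N: "\<And>k. k < e \<Longrightarrow> (gd \<eta> (\<lambda>x. f (x, \<phi>)) \<theta> k, \<phi>) \<in> N"
  shows "norm (gd \<eta> (\<lambda>x. f (x, \<phi>)) \<theta> e - \<theta>) \<le> \<eta> * real e * M"
  using N
proof (induction e)
  case (Suc e)
  let ?x = "gd \<eta> (\<lambda>x. f (x, \<phi>)) \<theta>"
  have "norm ((?x e - \<theta>) - \<eta> *\<^sub>R f (?x e, \<phi>)) \<le> \<eta> * real e * M + \<eta> * M"
    using Suc \<eta> by (intro norm_step_le f) auto
  then show ?case by (simp add: algebra_simps)
qed simp

text \<open>Step \<open>e\<close> uses the gradient at a point that is
  \<open>\<eta> * real e * M\<close> away from the start, which costs at most
  \<open>\<eta>\<^sup>2 * M\<^sup>2 * real e\<close>. The sum of these costs is bounded crudely by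
  the square.\<close>

lemma gd_first_order:
  fixes f :: "'v::real_normed_vector \<times> 'w::real_normed_vector \<Rightarrow> 'v"
  assumes f: "C2_bound N M f f'" and \<eta>: "0 \<le> \<eta>" and "e \<le> E"
    and N: "segments_in N ((\<lambda>k. (gd \<eta> (\<lambda>x. f (x, \<phi>)) \<theta> k, \<phi>)) ` {..<E})"
  shows "norm (gd \<eta> (\<lambda>x. f (x, \<phi>)) \<theta> e - (\<theta> - (\<eta> * real e) *\<^sub>R f (\<theta>, \<phi>)))
    \<le> \<eta>\<^sup>2 * M\<^sup>2 * (real e)\<^sup>2"
  using \<open>e \<le> E\<close>
proof (induction e)
  case (Suc e)
  let ?x = "gd \<eta> (\<lambda>x. f (x, \<phi>)) \<theta>"
  have M: "0 \<le> M" using C2_bound_nonneg[OF f] .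
  have "closed_segment (?x 0, \<phi>) (?x e, \<phi>) \<subseteq> N"
    using Suc.prems by (intro segments_inD[OF N] imageI) auto
  then have "norm (f (?x e, \<phi>) - f (\<theta>, \<phi>)) \<le> M * norm (?x e - \<theta>)"
    using C2_bound_lipschitz[OF f] by (fastforce simp: norm_Pair)
  also have "\<dots> \<le> M * (\<eta> * real e * M)"
    using Suc.prems
    by (intro mult_left_mono[OF _ M] gd_displacement[OF C2_bound_norm[OF f] \<eta>] segments_in_point[OF N])
       auto
  finally have *: "norm (f (?x e, \<phi>) - f (\<theta>, \<phi>)) \<le> \<eta> * M\<^sup>2 * real e"
    by (simp add: power2_eq_square mult_ac)
  have "norm (?x (Suc e) - (\<theta> - (\<eta> * real (Suc e)) *\<^sub>R f (\<theta>, \<phi>)))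
      = norm ((?x e - (\<theta> - (\<eta> * real e) *\<^sub>R f (\<theta>, \<phi>))) - \<eta> *\<^sub>R (f (?x e, \<phi>) - f (\<theta>, \<phi>)))"
    by (simp add: algebra_simps)
  also have "\<dots> \<le> \<eta>\<^sup>2 * M\<^sup>2 * (real e)\<^sup>2 + \<eta> * (\<eta> * M\<^sup>2 * real e)"
    using Suc * \<eta> by (intro norm_step_le) auto
  also have "\<dots> = \<eta>\<^sup>2 * M\<^sup>2 * ((real e)\<^sup>2 + real e)"
    by (simp add: algebra_simps power2_eq_square)
  also have "\<dots> \<le> \<eta>\<^sup>2 * M\<^sup>2 * (real (Suc e))\<^sup>2"
    by (intro mult_left_mono mult_nonneg_nonneg zero_le_power2) (simp add: power2_eq_square algebra_simps)
  finally show ?case .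
qed simp

lemma gd_second_order:
  fixes f :: "'v::real_normed_vector \<times> 'w::real_normed_vector \<Rightarrow> 'v"
  assumes f: "C2_bound N M f f'" and \<eta>: "0 \<le> \<eta>" and "e \<le> E"
    and N: "segments_in N ((\<lambda>k. (gd \<eta> (\<lambda>x. f (x, \<phi>)) \<theta> k, \<phi>)) ` {..<E})"
  shows "norm (gd \<eta> (\<lambda>x. f (x, \<phi>)) \<theta> e - (\<theta> - (\<eta> * real e) *\<^sub>R f (\<theta>, \<phi>)
      + (real (e choose 2) * \<eta>\<^sup>2) *\<^sub>R f' (\<theta>, \<phi>) (f (\<theta>, \<phi>), 0)))
    \<le> 2 * M ^ 3 * real e ^ 3 * \<eta> ^ 3"
  using \<open>e \<le> E\<close>
proof (induction e)
  case (Suc e)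
  let ?x = "gd \<eta> (\<lambda>x. f (x, \<phi>)) \<theta>"
  let ?g = "f (\<theta>, \<phi>)" and ?D = "\<lambda>v. f' (\<theta>, \<phi>) (v, 0)"
  let ?T = "\<lambda>e. \<theta> - (\<eta> * real e) *\<^sub>R ?g + (real (e choose 2) * \<eta>\<^sup>2) *\<^sub>R ?D ?g"
  have M: "0 \<le> M" using C2_bound_nonneg[OF f] .
  have pts: "(?x k, \<phi>) \<in> N" if "k < E" for k
    using that by (intro segments_in_point[OF N]) auto
  have pt0: "(\<theta>, \<phi>) \<in> N"
    using pts[of 0] Suc.prems by auto
  have D: "linear ?D"
    by (intro linearI) (auto simp flip: blinfun.add_right blinfun.scaleR_right)
  have "closed_segment (?x 0, \<phi>) (?x e, \<phi>) \<subseteq> N"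
    using Suc.prems by (intro segments_inD[OF N] imageI) auto
  from C2_bound_taylor[OF f this]
  have "norm (f (?x e, \<phi>) - ?g - ?D (?x e - \<theta>)) \<le> M * (norm (?x e - \<theta>))\<^sup>2"
    by (simp add: norm_Pair)
  also have "\<dots> \<le> M * (\<eta> * real e * M)\<^sup>2"
    using Suc.prems pts
    by (intro mult_left_mono[OF _ M] power_mono gd_displacement[OF C2_bound_norm[OF f] \<eta>]) auto
  finally have 1: "norm (f (?x e, \<phi>) - ?g - ?D (?x e - \<theta>)) \<le> \<eta>\<^sup>2 * M ^ 3 * (real e)\<^sup>2"
    by (simp add: power2_eq_square power3_eq_cube mult_ac)
  have "norm (?D (?x e - (\<theta> - (\<eta> * real e) *\<^sub>R ?g)))
      \<le> M * norm (?x e - (\<theta> - (\<eta> * real e) *\<^sub>R ?g), 0 :: 'w)"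
    by (rule C2_bound_apply[OF f pt0])
  also have "\<dots> \<le> M * (\<eta>\<^sup>2 * M\<^sup>2 * (real e)\<^sup>2)"
    using gd_first_order[OF f \<eta> _ N, of e] Suc.prems by (auto simp: norm_Pair intro!: mult_left_mono M)
  finally have 2: "norm (?D (?x e - (\<theta> - (\<eta> * real e) *\<^sub>R ?g))) \<le> \<eta>\<^sup>2 * M ^ 3 * (real e)\<^sup>2"
    by (simp add: power2_eq_square power3_eq_cube mult_ac)
  \<comment> \<open>Pascal's rule matches the new second-order contribution of step
    \<open>e\<close>.\<close>
  have ch: "real (Suc e choose 2) = real (e choose 2) + real e"
    by (simp add: numeral_2_eq_2)
  \<comment> \<open>The new error is the Taylor remainder of the gradient plus the derivative
    applied to the first-order path error. Both are of order \<open>\<eta>\<^sup>2\<close>, and the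
    step size adds the third power.\<close>
  have step: "?x (Suc e) - ?T (Suc e) = (?x e - ?T e) - \<eta> *\<^sub>R ((f (?x e, \<phi>) - ?g - ?D (?x e - \<theta>))
      + ?D (?x e - (\<theta> - (\<eta> * real e) *\<^sub>R ?g)))"
    by (simp add: ch linear_diff[OF D] linear_add[OF D] linear_scale[OF D] algebra_simps power2_eq_square)
  have "norm (?x (Suc e) - ?T (Suc e)) \<le> norm (?x e - ?T e) + \<eta> * (norm (f (?x e, \<phi>) - ?g - ?D (?x e - \<theta>))
      + norm (?D (?x e - (\<theta> - (\<eta> * real e) *\<^sub>R ?g))))"
    unfolding step by (intro norm_step_le order_refl norm_triangle_ineq \<eta>)
  also have "\<dots> \<le> 2 * M ^ 3 * real e ^ 3 * \<eta> ^ 3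
      + \<eta> * (\<eta>\<^sup>2 * M ^ 3 * (real e)\<^sup>2 + \<eta>\<^sup>2 * M ^ 3 * (real e)\<^sup>2)"
    using Suc.prems by (intro add_mono mult_left_mono Suc.IH 1 2 \<eta>) simp
  also have "\<dots> = 2 * M ^ 3 * (real e ^ 3 + (real e)\<^sup>2) * \<eta> ^ 3"
    by (simp add: algebra_simps power2_eq_square power3_eq_cube[of \<eta>])
  also have "\<dots> \<le> 2 * M ^ 3 * real (Suc e) ^ 3 * \<eta> ^ 3"
  proof (intro mult_right_mono mult_left_mono)
    have "(real e)\<^sup>2 * (real e + 1) \<le> (real (Suc e))\<^sup>2 * real (Suc e)"
      by (intro mult_mono power_mono) auto
    then show "real e ^ 3 + (real e)\<^sup>2 \<le> real (Suc e) ^ 3"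
      by (simp only: power2_eq_square power3_eq_cube distrib_left mult_1_right)
  qed (use M \<eta> in auto)
  finally show ?case .
qed (simp add: numeral_2_eq_2)

section \<open>Comparison of two descent paths\<close>

text \<open>A discrete Gronwall estimate: one step on (learner, source) pairs has Lipschitz factor
  \<open>1 + \<eta> * M\<close>. Working in the product space carries the constant difference of the
  sources along with that of the learners.\<close>

lemma gd_pair_growth:
  fixes f :: "'v::real_normed_vector \<times> 'w::real_normed_vector \<Rightarrow> 'v"
  defines "x \<equiv> \<lambda>\<eta> \<theta> \<phi>. gd \<eta> (\<lambda>x. f (x, \<phi>)) \<theta>"
  assumes f: "C2_bound N M f f'" and \<eta>: "0 \<le> \<eta>" and "e \<le> E"
    and N: "\<And>k. k < E \<Longrightarrow> closed_segment (x \<eta> \<theta> \<phi> k, \<phi>) (x \<eta> \<theta>' \<phi>' k, \<phi>') \<subseteq> N"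
  shows "norm ((x \<eta> \<theta>' \<phi>' e, \<phi>') - (x \<eta> \<theta> \<phi> e, \<phi>))
    \<le> (1 + \<eta> * M) ^ e * norm ((\<theta>', \<phi>') - (\<theta>, \<phi>))"
  using \<open>e \<le> E\<close>
proof (induction e)
  case (Suc e)
  let ?p = "\<lambda>k. (x \<eta> \<theta> \<phi> k, \<phi>)" and ?q = "\<lambda>k. (x \<eta> \<theta>' \<phi>' k, \<phi>')"
  have M: "0 \<le> M" using C2_bound_nonneg[OF f] .
  have "norm (?q (Suc e) - ?p (Suc e)) = norm ((?q e - ?p e) - \<eta> *\<^sub>R (f (?q e) - f (?p e), 0 :: 'w))"
    by (simp add: x_def algebra_simps)
  also have "\<dots> \<le> norm (?q e - ?p e) + \<eta> * norm (f (?q e) - f (?p e))"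
    using \<eta> by (intro norm_step_le) (auto simp: norm_Pair)
  also have "\<dots> \<le> norm (?q e - ?p e) + \<eta> * (M * norm (?q e - ?p e))"
    using C2_bound_lipschitz[OF f N, of e] Suc.prems \<eta> by (intro add_left_mono mult_left_mono) auto
  also have "\<dots> = (1 + \<eta> * M) * norm (?q e - ?p e)"
    by (simp add: algebra_simps)
  also have "\<dots> \<le> (1 + \<eta> * M) * ((1 + \<eta> * M) ^ e * norm ((\<theta>', \<phi>') - (\<theta>, \<phi>)))"
    using Suc \<eta> M by (intro mult_left_mono) auto
  finally show ?case by (simp add: mult_ac)
qed (simp add: x_def)

text \<open>Each step should change the learner difference by \<open>-\<eta>\<close> times the
  initial derivative applied to the initial pair difference. \<open>A\<close> bounds the pair
  distance at all steps, so the error per step is of order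
  \<open>\<eta> * A\<^sup>2 + \<eta>\<^sup>2 * A\<close>.\<close>

lemma gd_pair_expansion:
  fixes f :: "'v::real_normed_vector \<times> 'w::real_normed_vector \<Rightarrow> 'v"
  defines "x \<equiv> \<lambda>\<eta> \<theta> \<phi>. gd \<eta> (\<lambda>x. f (x, \<phi>)) \<theta>"
  assumes f: "C2_bound N M f f'" and \<eta>: "0 \<le> \<eta>" "\<eta> \<le> 1" and "e \<le> E"
    and N: "segments_in N ((\<lambda>k. (x \<eta> \<theta> \<phi> k, \<phi>)) ` {..<E} \<union> (\<lambda>k. (x \<eta> \<theta>' \<phi>' k, \<phi>')) ` {..<E})"
    and A: "A = (1 + M) ^ E * norm ((\<theta>', \<phi>') - (\<theta>, \<phi>))"
  shows "norm (x \<eta> \<theta>' \<phi>' e - x \<eta> \<theta> \<phi> e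
      - (\<theta>' - \<theta> - (\<eta> * real e) *\<^sub>R f' (\<theta>, \<phi>) ((\<theta>', \<phi>') - (\<theta>, \<phi>))))
    \<le> real e * (\<eta> * (M * A\<^sup>2 + 2 * (M\<^sup>2 * (\<eta> * real E) * A)))"
  using \<open>e \<le> E\<close>
proof (induction e)
  case (Suc e)
  let ?p = "\<lambda>k. (x \<eta> \<theta> \<phi> k, \<phi>)" and ?q = "\<lambda>k. (x \<eta> \<theta>' \<phi>' k, \<phi>')"
  let ?z0 = "(\<theta>', \<phi>') - (\<theta>, \<phi>)"
  have M: "0 \<le> M" using C2_bound_nonneg[OF f] .
  have seg: "closed_segment (?p k) (?q k) \<subseteq> N" "closed_segment (?p 0) (?p k) \<subseteq> N"
    "?p k \<in> N" "?q k \<in> N" if "k < E" for k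
  proof -
    have "?p k \<in> ?p ` {..<E} \<union> ?q ` {..<E}" "?q k \<in> ?p ` {..<E} \<union> ?q ` {..<E}"
      "?p 0 \<in> ?p ` {..<E} \<union> ?q ` {..<E}"
      using that by auto
    then show "closed_segment (?p k) (?q k) \<subseteq> N" "closed_segment (?p 0) (?p k) \<subseteq> N"
      "?p k \<in> N" "?q k \<in> N"
      using segments_inD[OF N] segments_in_point[OF N] by blast+
  qed
  have A0: "0 \<le> A" using M by (auto simp: A)
  have zA: "norm (?q k - ?p k) \<le> A" if "k \<le> E" for k
  proof -
    have "norm (?q k - ?p k) \<le> (1 + \<eta> * M) ^ k * norm ?z0"
      using that seg(1) unfolding x_def by (intro gd_pair_growth[OF f \<eta>(1)]) auto
    \<comment> \<open>Here \<open>\<eta> \<le> 1\<close> makes the growth factor independent of the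
      step size.\<close>
    also have "(1 + \<eta> * M) ^ k \<le> (1 + M) ^ k"
      using \<eta> M by (intro power_mono) (auto intro: mult_left_le_one_le)
    also have "(1 + M) ^ k \<le> (1 + M) ^ E"
      using that M by (intro power_increasing) auto
    finally show ?thesis by (simp add: A mult_right_mono)
  qed
  have e: "e < E" and e': "e \<le> E" using Suc.prems by auto
  \<comment> \<open>The difference of the paths is itself slowly varying: it changes by at most
    \<open>\<eta> * (M * A)\<close> per step.\<close>
  have drift: "norm ((?q k - ?p k) - ?z0) \<le> \<eta> * real k * (M * A)" if "k \<le> E" for k
    using that
  proof (induction k)
    case (Suc k)
    have "norm ((?q (Suc k) - ?p (Suc k)) - ?z0)
        = norm ((?q k - ?p k - ?z0) - \<eta> *\<^sub>R (f (?q k) - f (?p k), 0 :: 'w))"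
      by (simp add: x_def algebra_simps)
    also have "\<dots> \<le> norm (?q k - ?p k - ?z0) + \<eta> * norm (f (?q k) - f (?p k))"
      using \<eta> by (intro norm_step_le) (auto simp: norm_Pair)
    also have "\<dots> \<le> \<eta> * real k * (M * A) + \<eta> * (M * A)"
    proof (intro add_mono mult_left_mono \<eta>(1))
      show "norm (?q k - ?p k - ?z0) \<le> \<eta> * real k * (M * A)"
        using Suc by simp
      have "norm (f (?q k) - f (?p k)) \<le> M * norm (?q k - ?p k)"
        using Suc.prems by (intro C2_bound_lipschitz[OF f seg(1)]) simp
      also have "\<dots> \<le> M * A"
        using Suc.prems by (intro mult_left_mono zA M) simp
      finally show "norm (f (?q k) - f (?p k)) \<le> M * A" .
    qed
    finally show ?case by (simp add: algebra_simps)
  qed (simp add: x_def)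
  have "norm (f (?q e) - f (?p e) - f' (?p e) (?q e - ?p e)) \<le> M * (norm (?q e - ?p e))\<^sup>2"
    by (rule C2_bound_taylor[OF f seg(1)[OF e]])
  also have "\<dots> \<le> M * A\<^sup>2"
    using zA[OF e'] M by (intro mult_left_mono power_mono) auto
  finally have 1: "norm (f (?q e) - f (?p e) - f' (?p e) (?q e - ?p e)) \<le> M * A\<^sup>2" .
  have "norm (f' (?p e) - f' (?p 0)) \<le> M * norm (?p e - ?p 0)"
    by (rule C2_bound_deriv_lipschitz[OF f seg(2)[OF e]])
  also have "\<dots> = M * norm (x \<eta> \<theta> \<phi> e - \<theta>)"
    by (simp add: norm_Pair x_def)
  also have "\<dots> \<le> M * (\<eta> * real e * M)"
    unfolding x_def using seg(3) e unfolding x_def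
    by (intro mult_left_mono[OF _ M] gd_displacement[OF C2_bound_norm[OF f] \<eta>(1)]) auto
  also have "\<dots> \<le> M * (\<eta> * real E * M)"
    using e M \<eta> by (intro mult_left_mono mult_right_mono) auto
  finally have "norm (f' (?p e) - f' (\<theta>, \<phi>)) \<le> M\<^sup>2 * (\<eta> * real E)"
    by (simp add: x_def power2_eq_square mult_ac)
  then have "norm (f' (?p e) - f' (\<theta>, \<phi>)) * norm (?q e - ?p e) \<le> M\<^sup>2 * (\<eta> * real E) * A"
    using zA[OF e'] M \<eta> by (intro mult_mono) auto
  with norm_blinfun[of "f' (?p e) - f' (\<theta>, \<phi>)" "?q e - ?p e"]
  have 2: "norm ((f' (?p e) - f' (\<theta>, \<phi>)) (?q e - ?p e)) \<le> M\<^sup>2 * (\<eta> * real E) * A"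
    by linarith
  have "norm (f' (\<theta>, \<phi>) (?q e - ?p e - ?z0)) \<le> M * norm (?q e - ?p e - ?z0)"
    using e seg(3)[of 0] by (intro C2_bound_apply[OF f]) (simp add: x_def)
  also have "\<dots> \<le> M * (\<eta> * real e * (M * A))"
    by (rule mult_left_mono[OF drift[OF e'] M])
  also have "\<dots> \<le> M * (\<eta> * real E * (M * A))"
    using e' by (intro mult_left_mono mult_right_mono mult_nonneg_nonneg M A0 \<eta>) simp
  finally have 3: "norm (f' (\<theta>, \<phi>) (?q e - ?p e - ?z0)) \<le> M\<^sup>2 * (\<eta> * real E) * A"
    by (simp add: power2_eq_square mult_ac)
  let ?r = "f (?q e) - f (?p e) - f' (\<theta>, \<phi>) ?z0"
  \<comment> \<open>Three sources of error: linearization between the two current points, transport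
    of the derivative from the current point back to the start, and drift of the difference away
    from its initial value.\<close>
  have "?r = (f (?q e) - f (?p e) - f' (?p e) (?q e - ?p e))
      + (f' (?p e) - f' (\<theta>, \<phi>)) (?q e - ?p e) + f' (\<theta>, \<phi>) (?q e - ?p e - ?z0)"
    by (simp only: blinfun.diff_left blinfun.diff_right) simp
  also have "norm \<dots> \<le> M * A\<^sup>2 + M\<^sup>2 * (\<eta> * real E) * A + M\<^sup>2 * (\<eta> * real E) * A"
    using 1 2 3 by (intro norm_triangle_le add_mono) auto
  finally have r: "norm ?r \<le> M * A\<^sup>2 + 2 * (M\<^sup>2 * (\<eta> * real E) * A)"
    by (simp only: mult_2 add.assoc)
  have "x \<eta> \<theta>' \<phi>' (Suc e) - x \<eta> \<theta> \<phi> (Suc e) - (\<theta>' - \<theta> - (\<eta> * real (Suc e)) *\<^sub>R f' (\<theta>, \<phi>) ?z0)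
      = (x \<eta> \<theta>' \<phi>' e - x \<eta> \<theta> \<phi> e - (\<theta>' - \<theta> - (\<eta> * real e) *\<^sub>R f' (\<theta>, \<phi>) ?z0)) - \<eta> *\<^sub>R ?r"
    by (simp add: x_def algebra_simps)
  also have "norm \<dots> \<le> real e * (\<eta> * (M * A\<^sup>2 + 2 * (M\<^sup>2 * (\<eta> * real E) * A)))
      + \<eta> * (M * A\<^sup>2 + 2 * (M\<^sup>2 * (\<eta> * real E) * A))"
    by (intro norm_step_le Suc.IH[OF e'] r \<eta>)
  finally show ?case by (simp add: algebra_simps)
qed (simp add: x_def)

section \<open>Small steps keep a round inside a ball\<close>

text \<open>A bootstrap by strong induction: the earlier points lie in the ball, hence in
  \<open>N\<close>, where the gradient bound holds, and the resulting displacement bound puts the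
  next point in the ball.\<close>

lemma gd_in_ball:
  fixes f :: "'v::real_normed_vector \<times> 'w::real_normed_vector \<Rightarrow> 'v"
  assumes f: "\<And>z. z \<in> N \<Longrightarrow> norm (f z) \<le> M" and M: "0 \<le> M" and \<eta>: "0 \<le> \<eta>"
    and r: "ball (\<theta>, \<phi>) r \<subseteq> N" "\<eta> * real E * M < r" and "e \<le> E"
  shows "(gd \<eta> (\<lambda>x. f (x, \<phi>)) \<theta> e, \<phi>) \<in> ball (\<theta>, \<phi>) r"
  using \<open>e \<le> E\<close>
proof (induction e rule: less_induct)
  case (less e)
  have "norm (gd \<eta> (\<lambda>x. f (x, \<phi>)) \<theta> e - \<theta>) \<le> \<eta> * real e * M"
    using less r(1) by (intro gd_displacement[OF f \<eta>]) auto
  also have "\<dots> \<le> \<eta> * real E * M"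
    using less.prems M \<eta> by (intro mult_right_mono mult_left_mono) auto
  finally show ?case
    using r(2) by (simp add: dist_Pair_Pair dist_norm norm_minus_commute)
qed

text \<open>This discharges the segment condition near an interior point of \<open>N\<close>: all
  client and pooled points share one ball, which is convex.\<close>

lemma segments_in_round:
  fixes g :: "nat \<Rightarrow> 'v::real_normed_vector \<Rightarrow> 'v \<Rightarrow> 'v"
  assumes w: "\<And>i. i \<in> {1..K} \<Longrightarrow> w i \<ge> 0" "(\<Sum>i=1..K. w i) = 1"
    and g: "\<And>i \<theta> \<phi>. i \<in> {1..K} \<Longrightarrow> (\<theta>, \<phi>) \<in> N \<Longrightarrow> norm (g i \<theta> \<phi>) \<le> M"
    and M: "0 \<le> M" and \<eta>: "0 \<le> \<eta>"
    and r: "ball (\<theta>, \<phi>) r \<subseteq> N" "\<eta> * real E * M < r"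
  shows "segments_in N (fed_points K E g \<eta> \<theta> \<phi> \<union> pooled_points K w E g \<eta> \<theta> \<phi>)"
proof (rule segments_in_convex[OF convex_ball _ r(1)])
  have "(gd \<eta> (\<lambda>x. g i x \<phi>) \<theta> e, \<phi>) \<in> ball (\<theta>, \<phi>) r" if "i \<in> {1..K}" "e < E" for i e
    using gd_in_ball[where f = "\<lambda>(x, y). g i x y", OF _ M \<eta> r, of e] g[OF that(1)] that(2)
    by auto
  moreover have "(gd \<eta> (\<lambda>x. wmean K w (\<lambda>i. g i x \<phi>)) \<theta> e, \<phi>) \<in> ball (\<theta>, \<phi>) r" if "e < E" for e
    using gd_in_ball[where f = "\<lambda>(x, y). wmean K w (\<lambda>i. g i x y)", OF _ M \<eta> r, of e] that
      norm_wmean_le[OF w g] by auto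
  ultimately show "fed_points K E g \<eta> \<theta> \<phi> \<union> pooled_points K w E g \<eta> \<theta> \<phi> \<subseteq> ball (\<theta>, \<phi>) r"
    unfolding fed_points_def pooled_points_def by blast
qed

section \<open>Expansions of the round maps\<close>

text \<open>The second-order expansion is applied to every client path and to the pooled path, each
  with remainder \<open>b\<close>; averaging the clients keeps \<open>b\<close>, so the total is
  \<open>b + b\<close>.\<close>

lemma fed_pooled_expansion:
  fixes g :: "nat \<Rightarrow> real^'n \<Rightarrow> real^'n \<Rightarrow> real^'n"
  assumes w: "\<And>i. i \<in> {1..K} \<Longrightarrow> w i \<ge> 0" "(\<Sum>i=1..K. w i) = 1" and M: "0 \<le> M"
    and g: "\<And>i. i \<in> {1..K} \<Longrightarrow> C2_bound N M (\<lambda>(\<theta>, \<phi>). g i \<theta> \<phi>) (g' i)"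
    and \<eta>: "0 \<le> \<eta>" and E: "E \<ge> 1"
    and N: "segments_in N (fed_points K E g \<eta> \<theta> \<phi> \<union> pooled_points K w E g \<eta> \<theta> \<phi>)"
  shows "norm (fed_round K w E g \<eta> \<theta> \<phi> - pooled_round K w E g \<eta> \<theta> \<phi>
      - (real (E choose 2) * \<eta>\<^sup>2) *\<^sub>R client_drift K w g \<theta> \<phi>) \<le> 4 * M ^ 3 * real E ^ 3 * \<eta> ^ 3"
proof -
  define G where "G = wmean K w (\<lambda>i. g i \<theta> \<phi>)"
  define H where "H = wmean K w (\<lambda>i. learner_jac (g i) \<theta> \<phi>)"
  define c where "c = real (E choose 2) * \<eta>\<^sup>2"
  define T where "T = (\<lambda>i. \<theta> - (\<eta> * real E) *\<^sub>R g i \<theta> \<phi> + c *\<^sub>R (learner_jac (g i) \<theta> \<phi> *v g i \<theta> \<phi>))"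
  define b where "b = 2 * M ^ 3 * real E ^ 3 * \<eta> ^ 3"
  let ?h = "\<lambda>z. wmean K w (\<lambda>i. case z of (\<theta>, \<phi>) \<Rightarrow> g i \<theta> \<phi>)"
  let ?h' = "\<lambda>z. wmean K w (\<lambda>i. g' i z)"
  have h: "C2_bound N M ?h ?h'"
    by (rule C2_bound_wmean[OF w M g])
  \<comment> \<open>With \<open>E \<ge> 1\<close> the starting pair is the pooled point of index
    0.\<close>
  have pt: "(\<theta>, \<phi>) \<in> N"
    using E by (intro segments_in_point[OF N]) (force simp: pooled_points_def)
  have jac: "learner_jac (g i) \<theta> \<phi> *v v = g' i (\<theta>, \<phi>) (v, 0)" if "i \<in> {1..K}" for i v
    by (rule C2_bound_learner_jac[OF g[OF that] pt])
  have client: "norm (gd \<eta> (\<lambda>x. g i x \<phi>) \<theta> E - T i) \<le> b" if i: "i \<in> {1..K}" for i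
  proof -
    have "(\<lambda>e. (gd \<eta> (\<lambda>x. g i x \<phi>) \<theta> e, \<phi>)) ` {..<E} \<subseteq>
        fed_points K E g \<eta> \<theta> \<phi> \<union> pooled_points K w E g \<eta> \<theta> \<phi>"
      using i by (auto simp: fed_points_def)
    from gd_second_order[OF g[OF i] \<eta> order_refl, where \<theta> = \<theta> and \<phi> = \<phi> and E = E] segments_in_mono[OF N this]
    show ?thesis by (simp add: T_def b_def c_def jac[OF i])
  qed
  have F: "norm (wmean K w (\<lambda>i. gd \<eta> (\<lambda>x. g i x \<phi>) \<theta> E - T i)) \<le> b"
    by (intro norm_wmean_le w client)
  have "wmean K w (\<lambda>i. learner_jac (g i) \<theta> \<phi> *v v) = H *v v" for v
    unfolding H_def
    by (rule wmean_linear)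
       (intro linearI; simp add: matrix_vector_mult_add_rdistrib scaleR_matrix_vector_assoc)
  then have "wmean K w (\<lambda>i. g' i (\<theta>, \<phi>)) (v, 0) = H *v v" for v
    by (simp add: wmean_def blinfun.sum_left blinfun.scaleR_left jac)
  moreover have "(\<lambda>e. (gd \<eta> (\<lambda>x. wmean K w (\<lambda>i. g i x \<phi>)) \<theta> e, \<phi>)) ` {..<E} \<subseteq>
      fed_points K E g \<eta> \<theta> \<phi> \<union> pooled_points K w E g \<eta> \<theta> \<phi>"
    by (auto simp: pooled_points_def)
  ultimately have P: "norm (pooled_round K w E g \<eta> \<theta> \<phi> - (\<theta> - (\<eta> * real E) *\<^sub>R G + c *\<^sub>R (H *v G))) \<le> b"
    using gd_second_order[OF h \<eta> order_refl, where \<theta> = \<theta> and \<phi> = \<phi> and E = E] segments_in_mono[OF N]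
    by (simp add: pooled_round_def b_def c_def G_def)
  have "client_drift K w g \<theta> \<phi> = wmean K w (\<lambda>i. learner_jac (g i) \<theta> \<phi> *v g i \<theta> \<phi>) - H *v G"
    unfolding client_drift_def H_def G_def by (rule wmean_centered_product[OF w(2)])
  moreover have "wmean K w T
      = \<theta> - (\<eta> * real E) *\<^sub>R G + c *\<^sub>R wmean K w (\<lambda>i. learner_jac (g i) \<theta> \<phi> *v g i \<theta> \<phi>)"
    unfolding T_def G_def by (simp add: wmean_add wmean_diff wmean_const[OF w(2)] wmean_scaleR)
  ultimately have eq: "fed_round K w E g \<eta> \<theta> \<phi> - pooled_round K w E g \<eta> \<theta> \<phi> - c *\<^sub>R client_drift K w g \<theta> \<phi>
      = wmean K w (\<lambda>i. gd \<eta> (\<lambda>x. g i x \<phi>) \<theta> E - T i)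
        - (pooled_round K w E g \<eta> \<theta> \<phi> - (\<theta> - (\<eta> * real E) *\<^sub>R G + c *\<^sub>R (H *v G)))"
    by (simp add: fed_round_def wmean_diff scaleR_diff_right)
  have "norm (fed_round K w E g \<eta> \<theta> \<phi> - pooled_round K w E g \<eta> \<theta> \<phi> - c *\<^sub>R client_drift K w g \<theta> \<phi>) \<le> b + b"
    unfolding eq by (intro norm_triangle_le_diff add_mono F P)
  then show ?thesis
    unfolding c_def b_def by (simp add: mult_ac)
qed

text \<open>Source and learner start equal, so the initial pair difference is
  \<open>\<theta>' - \<theta>\<close> in both components. The joint derivative in this direction
  splits into the learner and source Jacobians, which is how \<open>H + B\<close> arises.\<close>

lemma fed_difference_expansion:
  fixes g :: "nat \<Rightarrow> real^'n \<Rightarrow> real^'n \<Rightarrow> real^'n"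
  assumes w: "\<And>i. i \<in> {1..K} \<Longrightarrow> w i \<ge> 0" "(\<Sum>i=1..K. w i) = 1" and M: "0 \<le> M"
    and g: "\<And>i. i \<in> {1..K} \<Longrightarrow> C2_bound N M (\<lambda>(\<theta>, \<phi>). g i \<theta> \<phi>) (g' i)"
    and \<eta>: "0 \<le> \<eta>" "\<eta> \<le> 1" and pt: "(\<theta>, \<theta>) \<in> N"
    and N: "segments_in N (fed_points K E g \<eta> \<theta>' \<theta>' \<union> fed_points K E g \<eta> \<theta> \<theta>)"
    and H: "H = wmean K w (\<lambda>i. learner_jac (g i) \<theta> \<theta>)"
    and B: "B = wmean K w (\<lambda>i. source_jac (g i) \<theta> \<theta>)"
    and c: "c = (1 + M) ^ E"
  shows "norm (fed_round K w E g \<eta> \<theta>' \<theta>' - fed_round K w E g \<eta> \<theta> \<theta>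
      - (mat 1 - (\<eta> * real E) *\<^sub>R (H + B)) *v (\<theta>' - \<theta>))
    \<le> real E * (4 * M * c\<^sup>2 + 4 * M\<^sup>2 * real E * c)
      * (\<eta>\<^sup>2 * norm (\<theta>' - \<theta>) + (norm (\<theta>' - \<theta>))\<^sup>2)"
proof -
  let ?\<delta> = "\<theta>' - \<theta>"
  define x where "x = (\<lambda>i \<theta>. gd \<eta> (\<lambda>x. g i x \<theta>) \<theta> E)"
  define R where "R = (\<lambda>i. x i \<theta>' - x i \<theta> - (?\<delta> - (\<eta> * real E) *\<^sub>R g' i (\<theta>, \<theta>) (?\<delta>, ?\<delta>)))"
  define A where "A = c * norm (?\<delta>, ?\<delta>)"
  have c0: "0 \<le> c" using M by (simp add: c)
  \<comment> \<open>The factor 2 accounts for both 4s in the constant: squared in the quadratic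
    term, doubled in the linear one.\<close>
  have "norm (?\<delta>, ?\<delta>) \<le> 2 * norm ?\<delta>"
    using norm_Pair_le[of ?\<delta> ?\<delta>] by simp
  then have A: "0 \<le> A" "A \<le> c * (2 * norm ?\<delta>)"
    using c0 by (auto simp: A_def intro: mult_left_mono)
  have client: "norm (R i) \<le> real E * (4 * M * c\<^sup>2 + 4 * M\<^sup>2 * real E * c)
      * (\<eta>\<^sup>2 * norm ?\<delta> + (norm ?\<delta>)\<^sup>2)" if i: "i \<in> {1..K}" for i
  proof -
    have "(\<lambda>k. (gd \<eta> (\<lambda>x. g i x \<theta>) \<theta> k, \<theta>)) ` {..<E} \<union> (\<lambda>k. (gd \<eta> (\<lambda>x. g i x \<theta>') \<theta>' k, \<theta>')) ` {..<E}
        \<subseteq> fed_points K E g \<eta> \<theta>' \<theta>' \<union> fed_points K E g \<eta> \<theta> \<theta>"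
      using i by (auto simp: fed_points_def)
    from segments_in_mono[OF N this]
      gd_pair_expansion[OF g[OF i] \<eta> order_refl, where \<theta> = \<theta> and \<phi> = \<theta> and \<theta>' = \<theta>' and \<phi>' = \<theta>' and A = A and E = E]
    have "norm (R i) \<le> real E * (\<eta> * (M * A\<^sup>2 + 2 * (M\<^sup>2 * (\<eta> * real E) * A)))"
      by (simp add: R_def x_def A_def c)
    also have "\<dots> = real E * (\<eta> * (M * A\<^sup>2) + 2 * (M\<^sup>2 * (\<eta>\<^sup>2 * real E) * A))"
      by (simp add: algebra_simps power2_eq_square)
    also have "\<dots> \<le> real E * (M * (c * (2 * norm ?\<delta>))\<^sup>2 + 2 * (M\<^sup>2 * (\<eta>\<^sup>2 * real E) * (c * (2 * norm ?\<delta>))))"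
    proof (intro mult_left_mono add_mono)
      \<comment> \<open>The spare factor \<open>\<eta>\<close> of the quadratic term is given up, as
        the claimed error has no step size there.\<close>
      have "\<eta> * (M * A\<^sup>2) \<le> 1 * (M * A\<^sup>2)"
        using \<eta> M by (intro mult_right_mono) auto
      also have "\<dots> \<le> M * (c * (2 * norm ?\<delta>))\<^sup>2"
        using A M by (simp add: mult_left_mono power_mono)
      finally show "\<eta> * (M * A\<^sup>2) \<le> M * (c * (2 * norm ?\<delta>))\<^sup>2" .
    qed (use A in auto)
    also have "\<dots> = real E * (4 * M * c\<^sup>2 * (norm ?\<delta>)\<^sup>2 + 4 * M\<^sup>2 * real E * c * (\<eta>\<^sup>2 * norm ?\<delta>))"
      by (simp add: power_mult_distrib)
    also have "\<dots> \<le> real E * (4 * M * c\<^sup>2 * (\<eta>\<^sup>2 * norm ?\<delta> + (norm ?\<delta>)\<^sup>2)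
        + 4 * M\<^sup>2 * real E * c * (\<eta>\<^sup>2 * norm ?\<delta> + (norm ?\<delta>)\<^sup>2))"
      using M c0 by (intro mult_left_mono add_mono) auto
    also have "\<dots> = real E * (4 * M * c\<^sup>2 + 4 * M\<^sup>2 * real E * c) * (\<eta>\<^sup>2 * norm ?\<delta> + (norm ?\<delta>)\<^sup>2)"
      by (simp only: distrib_right mult.assoc)
    finally show ?thesis .
  qed
  have R: "norm (wmean K w R) \<le> real E * (4 * M * c\<^sup>2 + 4 * M\<^sup>2 * real E * c)
      * (\<eta>\<^sup>2 * norm ?\<delta> + (norm ?\<delta>)\<^sup>2)"
    by (intro norm_wmean_le w client)
  have lin: "linear (\<lambda>C :: real^'n^'n. C *v ?\<delta>)"
    by (intro linearI) (auto simp: matrix_vector_mult_add_rdistrib scaleR_matrix_vector_assoc)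
  have "wmean K w (\<lambda>i. g' i (\<theta>, \<theta>) (?\<delta>, ?\<delta>))
      = wmean K w (\<lambda>i. (learner_jac (g i) \<theta> \<theta> + source_jac (g i) \<theta> \<theta>) *v ?\<delta>)"
    unfolding wmean_def
  proof (intro sum.cong refl arg_cong2[where f = scaleR])
    fix i assume i: "i \<in> {1..K}"
    have "g' i (\<theta>, \<theta>) (?\<delta>, ?\<delta>) = g' i (\<theta>, \<theta>) (?\<delta>, 0) + g' i (\<theta>, \<theta>) (0, ?\<delta>)"
      by (simp flip: blinfun.add_right)
    then show "g' i (\<theta>, \<theta>) (?\<delta>, ?\<delta>) = (learner_jac (g i) \<theta> \<theta> + source_jac (g i) \<theta> \<theta>) *v ?\<delta>"
      using C2_bound_learner_jac[OF g[OF i] pt] C2_bound_source_jac[OF g[OF i] pt]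
      by (simp add: matrix_vector_mult_add_rdistrib)
  qed
  also have "\<dots> = (H + B) *v ?\<delta>"
    by (simp only: wmean_linear[OF lin] wmean_add H B)
  finally have "wmean K w R = wmean K w (\<lambda>i. x i \<theta>') - wmean K w (\<lambda>i. x i \<theta>)
      - (?\<delta> - (\<eta> * real E) *\<^sub>R ((H + B) *v ?\<delta>))"
    by (simp only: R_def wmean_diff wmean_const[OF w(2)] wmean_scaleR)
  also have "\<dots> = fed_round K w E g \<eta> \<theta>' \<theta>' - fed_round K w E g \<eta> \<theta> \<theta>
      - (mat 1 - (\<eta> * real E) *\<^sub>R (H + B)) *v ?\<delta>"
    by (simp only: fed_round_def x_def matrix_vector_mult_diff_rdistrib matrix_vector_mul_lid
        scaleR_matrix_vector_assoc)
  finally show ?thesis using R by simp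
qed

text \<open>At a fixed interior point the segment condition follows from small
  \<open>\<eta>\<close>, so the first O-claim is unconditional there. The other two claims express
  uniformity by choosing the constant and the threshold before the points or processes.\<close>

theorem proposition2:
  fixes K E :: nat
    and w :: "nat \<Rightarrow> real"
    and \<mu> :: "'s measure"
    and d :: "nat \<Rightarrow> real^'n \<Rightarrow> 's measure"
    and p :: "nat \<Rightarrow> real^'n \<Rightarrow> 's \<Rightarrow> real"
    and S :: "'s set"
    and l :: "real^'n \<Rightarrow> 's \<Rightarrow> real"
    and g :: "nat \<Rightarrow> real^'n \<Rightarrow> real^'n \<Rightarrow> real^'n"
    and U N :: "((real^'n) \<times> (real^'n)) set"
  assumes E: "E \<ge> 1"
    and weights: "\<And>i. i \<in> {1..K} \<Longrightarrow> w i > 0" "(\<Sum>i=1..K. w i) = 1"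
    and nbhd: "compact N" "open U" "N \<subseteq> U"
    and distributions: "\<And>i \<phi>. i \<in> {1..K} \<Longrightarrow> prob_space (d i \<phi>)"
    and densities:
      "\<And>i \<phi>. i \<in> {1..K} \<Longrightarrow> \<phi> \<in> snd ` U \<Longrightarrow> p i \<phi> \<in> borel_measurable \<mu>"
      "\<And>i \<phi> s. i \<in> {1..K} \<Longrightarrow> \<phi> \<in> snd ` U \<Longrightarrow> p i \<phi> s \<ge> 0"
      "\<And>i \<phi>. i \<in> {1..K} \<Longrightarrow> \<phi> \<in> snd ` U \<Longrightarrow> d i \<phi> = density \<mu> (\<lambda>s. ennreal (p i \<phi> s))"
    and common_support:
      "\<And>i \<phi>. i \<in> {1..K} \<Longrightarrow> \<phi> \<in> snd ` U \<Longrightarrow> AE s in \<mu>. p i \<phi> s > 0 \<longleftrightarrow> s \<in> S"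
    and loss_measurable: "\<And>\<theta>. \<theta> \<in> fst ` U \<Longrightarrow> l \<theta> \<in> borel_measurable \<mu>"
    and domination:
      "\<And>i. i \<in> {1..K} \<Longrightarrow> dominated_diff \<mu> U (\<lambda>(\<theta>, \<phi>) s. p i \<phi> s * l \<theta> s)"
      "\<And>i. i \<in> {1..K} \<Longrightarrow>
         dominated_diff \<mu> U (\<lambda>(\<theta>, \<phi>) s. p i \<phi> s *\<^sub>R grad (\<lambda>x. l x s) \<theta>)"
    and g: "g = client_grad d l"
    and regularity: "\<And>i. i \<in> {1..K} \<Longrightarrow> C2_regular U N (\<lambda>(\<theta>, \<phi>). g i \<theta> \<phi>)"
  shows
    "(\<forall>(\<theta>, \<phi>) \<in> interior N.
      (\<lambda>\<eta>. norm (fed_round K w E g \<eta> \<theta> \<phi> - pooled_round K w E g \<eta> \<theta> \<phi>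
          - (real (E choose 2) * \<eta>\<^sup>2) *\<^sub>R client_drift K w g \<theta> \<phi>)) \<in> O[at_right 0](\<lambda>\<eta>. \<eta> ^ 3))
   \<and> (\<exists>C. \<exists>\<eta>\<^sub>0>0. \<forall>\<eta>. 0 < \<eta> \<and> \<eta> \<le> \<eta>\<^sub>0 \<longrightarrow>
        (\<forall>\<theta> \<phi>. segments_in N (fed_points K E g \<eta> \<theta> \<phi> \<union> pooled_points K w E g \<eta> \<theta> \<phi>) \<longrightarrow>
           norm (fed_round K w E g \<eta> \<theta> \<phi> - pooled_round K w E g \<eta> \<theta> \<phi>
               - (real (E choose 2) * \<eta>\<^sup>2) *\<^sub>R client_drift K w g \<theta> \<phi>)
             \<le> C * \<eta> ^ 3))
   \<and> (\<exists>C. \<exists>\<eta>\<^sub>0>0. \<forall>\<eta>. 0 < \<eta> \<and> \<eta> \<le> \<eta>\<^sub>0 \<longrightarrow>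
        (\<forall>\<theta>F \<theta>P :: nat \<Rightarrow> real^'n.
           (\<forall>t. \<theta>F (Suc t) = fed_round K w E g \<eta> (\<theta>F t) (\<theta>F t)) \<and>
           (\<forall>t. \<theta>P (Suc t) = pooled_round K w E g \<eta> (\<theta>P t) (\<theta>P t)) \<longrightarrow>
           (\<forall>t. segments_in N
                  (fed_points K E g \<eta> (\<theta>F t) (\<theta>F t) \<union> fed_points K E g \<eta> (\<theta>P t) (\<theta>P t)
                    \<union> pooled_points K w E g \<eta> (\<theta>P t) (\<theta>P t)) \<longrightarrow>
              (let \<delta> = (\<lambda>t. \<theta>F t - \<theta>P t);
                   e = fed_round K w E g \<eta> (\<theta>P t) (\<theta>P t) - pooled_round K w E g \<eta> (\<theta>P t) (\<theta>P t);
                   H = wmean K w (\<lambda>i. learner_jac (g i) (\<theta>P t) (\<theta>P t));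
                   B = wmean K w (\<lambda>i. source_jac (g i) (\<theta>P t) (\<theta>P t))
               in norm (\<delta> (Suc t) - ((mat 1 - (\<eta> * real E) *\<^sub>R (H + B)) *v \<delta> t + e))
                    \<le> C * (\<eta>\<^sup>2 * norm (\<delta> t) + (norm (\<delta> t))\<^sup>2)))))"
proof -
  have w: "\<And>i. i \<in> {1..K} \<Longrightarrow> w i \<ge> 0" "(\<Sum>i=1..K. w i) = 1"
    using weights by (auto intro: less_imp_le)
  obtain M g' where M: "0 \<le> M"
    and g': "\<And>i. i \<in> {1..K} \<Longrightarrow> C2_bound N M (\<lambda>(\<theta>, \<phi>). g i \<theta> \<phi>) (g' i)"
    using C2_bound_common[where f = "\<lambda>i (\<theta>, \<phi>). g i \<theta> \<phi>", OF regularity nbhd(3)] by blast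
  note expansion = fed_pooled_expansion[where g = g and g' = g' and w = w and K = K, OF w M g' _ E]
  show ?thesis
  proof (intro conjI)
    show "\<forall>(\<theta>, \<phi>) \<in> interior N.
      (\<lambda>\<eta>. norm (fed_round K w E g \<eta> \<theta> \<phi> - pooled_round K w E g \<eta> \<theta> \<phi>
          - (real (E choose 2) * \<eta>\<^sup>2) *\<^sub>R client_drift K w g \<theta> \<phi>)) \<in> O[at_right 0](\<lambda>\<eta>. \<eta> ^ 3)"
    proof (clarify)
      fix \<theta> \<phi> assume int: "(\<theta>, \<phi>) \<in> interior N"
      obtain r where r: "0 < r" "ball (\<theta>, \<phi>) r \<subseteq> N"
        using int by (auto simp: mem_interior)
      \<comment> \<open>The total displacement in a round tends to 0, so it is eventually below the
        radius of a ball inside \<open>N\<close>.\<close>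
      have "((\<lambda>\<eta>. \<eta> * real E * M) \<longlongrightarrow> 0 * real E * M) (at_right 0)"
        by (intro tendsto_intros)
      then have "\<forall>\<^sub>F \<eta> in at_right 0. \<eta> * real E * M < r"
        using r(1) by (intro order_tendstoD(2)) auto
      moreover have "\<forall>\<^sub>F \<eta> :: real in at_right 0. 0 < \<eta>"
        by (rule eventually_at_right_less)
      ultimately have "\<forall>\<^sub>F \<eta> in at_right 0.
          norm (fed_round K w E g \<eta> \<theta> \<phi> - pooled_round K w E g \<eta> \<theta> \<phi>
            - (real (E choose 2) * \<eta>\<^sup>2) *\<^sub>R client_drift K w g \<theta> \<phi>)
          \<le> 4 * M ^ 3 * real E ^ 3 * \<eta> ^ 3"
      proof eventually_elim
        case (elim \<eta>)
        have "norm (g i \<theta> \<phi>) \<le> M" if "i \<in> {1..K}" "(\<theta>, \<phi>) \<in> N" for i \<theta> \<phi>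
          using C2_bound_norm[OF g'[OF that(1)] that(2)] by simp
        with elim show ?case
          by (intro expansion segments_in_round[OF w _ M _ r(2)]) auto
      qed
      then show "(\<lambda>\<eta>. norm (fed_round K w E g \<eta> \<theta> \<phi> - pooled_round K w E g \<eta> \<theta> \<phi>
          - (real (E choose 2) * \<eta>\<^sup>2) *\<^sub>R client_drift K w g \<theta> \<phi>)) \<in> O[at_right 0](\<lambda>\<eta>. \<eta> ^ 3)"
      proof (intro bigoI[where c = "4 * M ^ 3 * real E ^ 3"], elim eventually_mono)
        fix \<eta> :: real
        let ?u = "norm (fed_round K w E g \<eta> \<theta> \<phi> - pooled_round K w E g \<eta> \<theta> \<phi>
            - (real (E choose 2) * \<eta>\<^sup>2) *\<^sub>R client_drift K w g \<theta> \<phi>)"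
        assume "?u \<le> 4 * M ^ 3 * real E ^ 3 * \<eta> ^ 3"
        also have "\<dots> \<le> 4 * M ^ 3 * real E ^ 3 * norm (\<eta> ^ 3)"
          using M by (intro mult_left_mono) auto
        finally show "norm ?u \<le> 4 * M ^ 3 * real E ^ 3 * norm (\<eta> ^ 3)"
          by simp
      qed
    qed
  next
    show "\<exists>C. \<exists>\<eta>\<^sub>0>0. \<forall>\<eta>. 0 < \<eta> \<and> \<eta> \<le> \<eta>\<^sub>0 \<longrightarrow>
        (\<forall>\<theta> \<phi>. segments_in N (fed_points K E g \<eta> \<theta> \<phi> \<union> pooled_points K w E g \<eta> \<theta> \<phi>) \<longrightarrow>
           norm (fed_round K w E g \<eta> \<theta> \<phi> - pooled_round K w E g \<eta> \<theta> \<phi>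
               - (real (E choose 2) * \<eta>\<^sup>2) *\<^sub>R client_drift K w g \<theta> \<phi>)
             \<le> C * \<eta> ^ 3)"
    \<comment> \<open>The expansion holds for every nonnegative step size, so the threshold 1 is an
      arbitrary choice.\<close>
    by (intro exI[of _ "4 * M ^ 3 * real E ^ 3"] exI[of _ 1] conjI allI impI expansion) auto
  next
    show "\<exists>C. \<exists>\<eta>\<^sub>0>0. \<forall>\<eta>. 0 < \<eta> \<and> \<eta> \<le> \<eta>\<^sub>0 \<longrightarrow>
        (\<forall>\<theta>F \<theta>P :: nat \<Rightarrow> real^'n.
           (\<forall>t. \<theta>F (Suc t) = fed_round K w E g \<eta> (\<theta>F t) (\<theta>F t)) \<and>
           (\<forall>t. \<theta>P (Suc t) = pooled_round K w E g \<eta> (\<theta>P t) (\<theta>P t)) \<longrightarrow>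
           (\<forall>t. segments_in N
                  (fed_points K E g \<eta> (\<theta>F t) (\<theta>F t) \<union> fed_points K E g \<eta> (\<theta>P t) (\<theta>P t)
                    \<union> pooled_points K w E g \<eta> (\<theta>P t) (\<theta>P t)) \<longrightarrow>
              (let \<delta> = (\<lambda>t. \<theta>F t - \<theta>P t);
                   e = fed_round K w E g \<eta> (\<theta>P t) (\<theta>P t) - pooled_round K w E g \<eta> (\<theta>P t) (\<theta>P t);
                   H = wmean K w (\<lambda>i. learner_jac (g i) (\<theta>P t) (\<theta>P t));
                   B = wmean K w (\<lambda>i. source_jac (g i) (\<theta>P t) (\<theta>P t))
               in norm (\<delta> (Suc t) - ((mat 1 - (\<eta> * real E) *\<^sub>R (H + B)) *v \<delta> t + e))
                    \<le> C * (\<eta>\<^sup>2 * norm (\<delta> t) + (norm (\<delta> t))\<^sup>2))))"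
    \<comment> \<open>Here the threshold 1 is the bound \<open>\<eta> \<le> 1\<close> of
      \<open>fed_difference_expansion\<close>, and the constant is the one found there.\<close>
    proof (rule exI[of _ "real E * (4 * M * ((1 + M) ^ E)\<^sup>2 + 4 * M\<^sup>2 * real E * (1 + M) ^ E)"],
        rule exI[of _ 1], unfold Let_def, intro conjI allI impI, rule zero_less_one, elim conjE)
      fix \<eta> t and \<theta>F \<theta>P :: "nat \<Rightarrow> real^'n"
      assume \<eta>: "0 < \<eta>" "\<eta> \<le> 1"
        and F: "\<forall>t. \<theta>F (Suc t) = fed_round K w E g \<eta> (\<theta>F t) (\<theta>F t)"
        and P: "\<forall>t. \<theta>P (Suc t) = pooled_round K w E g \<eta> (\<theta>P t) (\<theta>P t)"
        and N: "segments_in N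
          (fed_points K E g \<eta> (\<theta>F t) (\<theta>F t) \<union> fed_points K E g \<eta> (\<theta>P t) (\<theta>P t)
            \<union> pooled_points K w E g \<eta> (\<theta>P t) (\<theta>P t))"
      let ?f = "\<lambda>\<theta>. fed_round K w E g \<eta> \<theta> \<theta>"
      let ?A = "mat 1 - (\<eta> * real E) *\<^sub>R (wmean K w (\<lambda>i. learner_jac (g i) (\<theta>P t) (\<theta>P t))
          + wmean K w (\<lambda>i. source_jac (g i) (\<theta>P t) (\<theta>P t)))"
      have pt: "(\<theta>P t, \<theta>P t) \<in> N"
        using E by (intro segments_in_point[OF N]) (force simp: pooled_points_def)
      have "segments_in N (fed_points K E g \<eta> (\<theta>F t) (\<theta>F t) \<union> fed_points K E g \<eta> (\<theta>P t) (\<theta>P t))"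
        using N by (rule segments_in_mono) auto
      note fed_difference_expansion[where g = g and g' = g' and w = w and K = K,
          OF w M g' less_imp_le[OF \<eta>(1)] \<eta>(2) pt this refl refl refl]
      \<comment> \<open>The pooled round cancels against the one-round discrepancy, leaving the
        federated map at the two current learners.\<close>
      moreover have "\<theta>F (Suc t) - \<theta>P (Suc t) - (?A *v (\<theta>F t - \<theta>P t)
          + (?f (\<theta>P t) - pooled_round K w E g \<eta> (\<theta>P t) (\<theta>P t)))
          = ?f (\<theta>F t) - ?f (\<theta>P t) - ?A *v (\<theta>F t - \<theta>P t)"
        using F P by simp
      ultimately show "norm (\<theta>F (Suc t) - \<theta>P (Suc t) - (?A *v (\<theta>F t - \<theta>P t)
          + (?f (\<theta>P t) - pooled_round K w E g \<eta> (\<theta>P t) (\<theta>P t))))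
          \<le> real E * (4 * M * ((1 + M) ^ E)\<^sup>2 + 4 * M\<^sup>2 * real E * (1 + M) ^ E)
            * (\<eta>\<^sup>2 * norm (\<theta>F t - \<theta>P t) + (norm (\<theta>F t - \<theta>P t))\<^sup>2)"
        by (simp only:)
    qed
  qed
qed

end
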